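(* Let $n$ be a large odd integer, let $d\ge1$ and $1\le k\le d$ be integers, and let $E\subset\mathbb{Z}_n^d$. Suppose that \[ |E| \gg \frac{\sqrt{\tau(n)}\, n^{d+\frac{k-1}{2}}}{\gamma(n)^{(d-1)/2}}. \] Then $E$ determines a positive proportion of all dot-product $k$-simplices, i.e. \[ |\mathcal{P}_k(E)| \gg n^{\binom{k+1}{2}}. \]
   Context: $\mathbb{Z}_n$ is the ring of residues modulo $n$. For $x,y\in\mathbb{Z}_n^d$, $x\cdot y=x_1y_1+\dots+x_dy_d$. $\gamma(n)$ is the smallest prime divisor of $n$ and $\tau(n)$ is the number of divisors of $n$. A tuple $l_k=(t_{i,j})_{0\le i<j\le k}\in\mathbb{Z}_n^{\binom{k+1}{2}}$ is a dot-product $k$-simplex type; the set of dot-product $k$-simplices determined by $E$ is $\mathcal{P}_k(E)=\{l_k : \exists\, x_0,\dots,x_k\in E \text{ with } x_i\cdot x_j=t_{i,j} \text{ for all } 0\le i<j\le k\}$. Notation: $X\gg Y$ means $X\ge CY$ for some constant $C>0$ independent of $n$ and $E$ (it may depend on $d,k$); a hypothesis $|E|\gg Y$ means $|E|\ge CY$ for a suitable sufficiently large such constant $C$. *)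

theory Defs
  imports Complex_Main "HOL-Library.FuncSet" "HOL-Number_Theory.Residues"
begin

abbreviation Zn :: "nat \<Rightarrow> int ring"
  where "Zn n \<equiv> residue_ring (int n)"

(* Vectors and simplex types are extensional functions on their index set, so that
   equal vectors (types) are equal functions and card counts them correctly. *)
definition Zn_vectors :: "nat \<Rightarrow> nat \<Rightarrow> (nat \<Rightarrow> int) set"
  where "Zn_vectors n d = {1..d} \<rightarrow>\<^sub>E carrier (Zn n)"

definition dot_product :: "nat \<Rightarrow> nat \<Rightarrow> (nat \<Rightarrow> int) \<Rightarrow> (nat \<Rightarrow> int) \<Rightarrow> int"
  where "dot_product n d x y = (\<Oplus>\<^bsub>Zn n\<^esub>i\<in>{1..d}. x i \<otimes>\<^bsub>Zn n\<^esub> y i)"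

(* The least element of an empty set is unspecified; only meaningful for n \<noteq> 1. *)
definition least_prime_divisor :: "nat \<Rightarrow> nat"
  where "least_prime_divisor n = (LEAST p. prime p \<and> p dvd n)"

definition num_divisors :: "nat \<Rightarrow> nat"
  where "num_divisors n = card {m. m dvd n}"

definition simplex_index :: "nat \<Rightarrow> (nat \<times> nat) set"
  where "simplex_index k = {(i, j). i < j \<and> j \<le> k}"

definition simplex_types :: "nat \<Rightarrow> nat \<Rightarrow> (nat \<times> nat \<Rightarrow> int) set"
  where "simplex_types n k = simplex_index k \<rightarrow>\<^sub>E carrier (Zn n)"

definition dot_product_simplices ::
    "nat \<Rightarrow> nat \<Rightarrow> nat \<Rightarrow> (nat \<Rightarrow> int) set \<Rightarrow> (nat \<times> nat \<Rightarrow> int) set"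
  where "dot_product_simplices n d k E =
    {t \<in> simplex_types n k.
       \<exists>x :: nat \<Rightarrow> nat \<Rightarrow> int. (\<forall>i\<le>k. x i \<in> E) \<and>
         (\<forall>i j. i < j \<and> j \<le> k \<longrightarrow> dot_product n d (x i) (x j) = t (i, j))}"

end

theory Submission
  imports Defs "HOL-Analysis.Convex" "HOL-Library.Real_Mod"
begin

text \<open>
  For $x, x' \in E$ let $N(x,x')$ be the number of $z \in E$ with $x \cdot z = x' \cdot z$. The number
  of coincidences among all stars $(x \cdot z_1, \dots, x \cdot z_j)$ with $x, z_1, \dots, z_j \in E$
  is the moment $\sum_{x,x'} N(x,x')^j$. Expanding $n N = |E| + R$ into additive characters, where
  $R$ collects the nonzero frequencies $s$, one has to bound
  $\sum_{x,x'} (n N)^j R$ by $(n|E|)^j$ times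
  $\max_m \sum_{s \ne 0} \sum_{z \in E} |\widehat{1_E}(m + s z)|^2$. Extending the sum over $z$ to the
  whole module gives at most $n^d |E| \gcd(s,n)^d$ for each $s$, and
  $\sum_{s \ne 0} \gcd(s,n)^d \le \tau(n)\, n\, (n/\gamma(n))^{d-1}$. Under the size hypothesis the
  moment is thus at most $2|E|^{j+2}/n^j$ for each $j \le k$, so by Cauchy--Schwarz most
  $j$-tuples are the base of a positive proportion of all $n^j$ stars. Simplices are then built
  up one vertex at a time, inducting over the statement for arbitrary dense families of tuples.
\<close>

section \<open>Simplex types from star collisions\<close>

text \<open>Cauchy-Schwarz over the fibres of \<open>f\<close>: the fibre sizes sum to
  \<open>card A\<close>, and their squares sum to the number of colliding pairs.\<close>

lemma card_power2_le_image_times_collisions: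
  assumes "finite A"
  shows "(card A)\<^sup>2 \<le> card (f ` A) * card {p \<in> A \<times> A. f (fst p) = f (snd p)}"
proof -
  define F where "F t = {x \<in> A. f x = t}" for t
  have A: "A = (\<Union>t\<in>f ` A. F t)" by (auto simp: F_def)
  have "card A = (\<Sum>t\<in>f ` A. card (F t))"
    by (subst A, subst card_UN_disjoint) (use assms in \<open>auto simp: F_def\<close>)
  moreover have "{p \<in> A \<times> A. f (fst p) = f (snd p)} = (\<Union>t\<in>f ` A. F t \<times> F t)"
    by (auto simp: F_def)
  then have "card {p \<in> A \<times> A. f (fst p) = f (snd p)} = (\<Sum>t\<in>f ` A. card (F t \<times> F t))"
    by (simp only:) (subst card_UN_disjoint, use assms in \<open>auto simp: F_def\<close>)
  moreover have "(\<Sum>t\<in>f ` A. real (card (F t)))\<^sup>2 \<le> (\<Sum>t\<in>f ` A. (real (card (F t)))\<^sup>2) * real (card (f ` A))"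
    by (rule sum_squared_le_sum_of_squares)
  ultimately have "(real (card A))\<^sup>2
      \<le> real (card {p \<in> A \<times> A. f (fst p) = f (snd p)}) * real (card (f ` A))"
    by (simp add: card_cartesian_product power2_eq_square)
  then show ?thesis
    by (simp only: of_nat_mult[symmetric] of_nat_power[symmetric] of_nat_le_iff mult.commute)
qed

section \<open>Types of tuples and collisions of stars\<close>

abbreviation tuples :: "'a set \<Rightarrow> nat \<Rightarrow> 'a list set"
  where "tuples E j \<equiv> {xs. set xs \<subseteq> E \<and> length xs = j}"

text \<open>The strictly upper triangular part of the Gram matrix, row by row. Prepending a vertex
  to a base prepends its star over that base and keeps the type of the base as tail, which is what
  the induction on vertices uses.\<close>

primrec tuple_type :: "('a \<Rightarrow> 'a \<Rightarrow> 'b) \<Rightarrow> 'a list \<Rightarrow> 'b list list" where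
  "tuple_type D [] = []"
| "tuple_type D (x # xs) = map (D x) xs # tuple_type D xs"

lemma tuple_type_eqI:
  assumes "length xs = length ys"
    and "\<And>i j. i < j \<Longrightarrow> j < length xs \<Longrightarrow> D (xs ! i) (xs ! j) = D (ys ! i) (ys ! j)"
  shows "tuple_type D xs = tuple_type D ys"
  using assms
proof (induction xs ys rule: list_induct2)
  case (Cons x xs y ys)
  have "D x (xs ! j) = D y (ys ! j)" if "j < length xs" for j
    using Cons.prems[of 0 "Suc j"] that by simp
  then have "map (D x) xs = map (D y) ys"
    using Cons.hyps by (simp add: list_eq_iff_nth_eq)
  moreover have "tuple_type D xs = tuple_type D ys"
    by (rule Cons.IH) (use Cons.prems[of "Suc _" "Suc _"] in simp)
  ultimately show ?case
    by simp
qed simp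

definition agreement :: "'a set \<Rightarrow> ('a \<Rightarrow> 'a \<Rightarrow> 'b) \<Rightarrow> 'a \<times> 'a \<Rightarrow> nat"
  where "agreement E D p = card {w \<in> E. D (fst p) w = D (snd p) w}"

definition star_collisions :: "'a set \<Rightarrow> ('a \<Rightarrow> 'a \<Rightarrow> 'b) \<Rightarrow> 'a list \<Rightarrow> nat"
  where "star_collisions E D z = card {p \<in> E \<times> E. map (D (fst p)) z = map (D (snd p)) z}"

text \<open>Double counting: for a fixed pair \<open>p\<close>, the two stars over \<open>z\<close>
  coincide exactly when every entry of \<open>z\<close> lies in the agreement set of
  \<open>p\<close>. Moment bounds thus control the average number of collisions over a base.\<close>

lemma sum_star_collisions:
  assumes "finite E"
  shows "(\<Sum>z\<in>tuples E j. star_collisions E D z) = (\<Sum>p\<in>E \<times> E. agreement E D p ^ j)"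
proof -
  have fin: "finite (tuples E j)" using assms by (rule finite_lists_length_eq)
  have "(\<Sum>z\<in>tuples E j. star_collisions E D z)
      = (\<Sum>z\<in>tuples E j. \<Sum>p\<in>E \<times> E. if map (D (fst p)) z = map (D (snd p)) z then 1 else 0)"
    unfolding star_collisions_def
    by (intro sum.cong refl) (use assms in \<open>simp add: sum.If_cases Int_def\<close>)
  also have "\<dots> = (\<Sum>p\<in>E \<times> E. \<Sum>z\<in>tuples E j. if map (D (fst p)) z = map (D (snd p)) z then 1 else 0)"
    by (rule sum.swap)
  also have "\<dots> = (\<Sum>p\<in>E \<times> E. card (tuples {w \<in> E. D (fst p) w = D (snd p) w} j))"
  proof (intro sum.cong refl)
    fix p
    have "tuples E j \<inter> {z. map (D (fst p)) z = map (D (snd p)) z}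
        = tuples {w \<in> E. D (fst p) w = D (snd p) w} j" by auto
    then show "(\<Sum>z\<in>tuples E j. if map (D (fst p)) z = map (D (snd p)) z then 1 else 0)
        = card (tuples {w \<in> E. D (fst p) w = D (snd p) w} j)"
      using fin by (simp add: sum.If_cases del: map_eq_conv)
  qed
  also have "\<dots> = (\<Sum>p\<in>E \<times> E. agreement E D p ^ j)"
    using assms by (simp add: agreement_def card_lists_length_eq)
  finally show ?thesis .
qed

text \<open>The constant lost in the induction: \<open>\<eta> ^ 3 / 32\<close> is the proportion of
  stars realised over each surviving base, \<open>\<eta> / 4\<close> the density of the surviving
  bases.\<close>

primrec simplex_density :: "nat \<Rightarrow> real \<Rightarrow> real" where
  "simplex_density 0 \<eta> = 1"
| "simplex_density (Suc j) \<eta> = \<eta> ^ 3 / 32 * simplex_density j (\<eta> / 4)"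

lemma simplex_density_pos: "\<eta> > 0 \<Longrightarrow> simplex_density j \<eta> > 0"
  by (induction j arbitrary: \<eta>) auto

text \<open>A type with one more vertex is a pair of a star and a base type. Since every base in
  \<open>G'\<close> carries many stars, one representative base for each type suffices, and
  different pairs give different types.\<close>

lemma card_cons_stars:
  assumes "finite G'" "finite E"
    and G': "\<And>z. z \<in> G' \<Longrightarrow> real (card ((\<lambda>x. map (D x) z) ` {x \<in> E. x # z \<in> G})) \<ge> b"
    and "finite G"
  shows "real (card (tuple_type D ` G)) \<ge> b * real (card (tuple_type D ` G'))"
proof -
  define T where "T = tuple_type D ` G'"
  define rep where "rep = inv_into G' (tuple_type D)"
  have rep: "rep t \<in> G'" "tuple_type D (rep t) = t" if "t \<in> T" for t
    using that unfolding T_def rep_def by (auto intro: inv_into_into f_inv_into_f)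
  define S where "S t = (\<lambda>x. map (D x) (rep t)) ` {x \<in> E. x # rep t \<in> G}" for t
  have "(\<lambda>(t, s). s # t) ` (SIGMA t:T. S t) \<subseteq> tuple_type D ` G"
  proof clarify
    fix t s assume "t \<in> T" "s \<in> S t"
    then obtain x where "x # rep t \<in> G" "s = map (D x) (rep t)" by (auto simp: S_def)
    then have "s # t = tuple_type D (x # rep t)" using rep \<open>t \<in> T\<close> by simp
    then show "s # t \<in> tuple_type D ` G" using \<open>x # rep t \<in> G\<close> by blast
  qed
  then have "card ((\<lambda>(t, s). s # t) ` (SIGMA t:T. S t)) \<le> card (tuple_type D ` G)"
    by (intro card_mono) (use assms in auto)
  moreover have "card ((\<lambda>(t, s). s # t) ` (SIGMA t:T. S t)) = card (SIGMA t:T. S t)"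
    by (intro card_image) (auto simp: inj_on_def)
  moreover have "card (SIGMA t:T. S t) = (\<Sum>t\<in>T. card (S t))"
    by (intro card_SigmaI) (use assms in \<open>auto simp: T_def S_def\<close>)
  moreover have "(\<Sum>t\<in>T. real (card (S t))) \<ge> (\<Sum>t\<in>T. b)"
    unfolding S_def by (intro sum_mono G' rep)
  ultimately show ?thesis
    by (simp add: T_def mult.commute flip: of_nat_sum)
qed

text \<open>Averaging over the bases \<open>z\<close>: those outside the rich set account for at
  most half of the density of \<open>G\<close>, and the fibre of a rich one has at most
  \<open>card E\<close> elements.\<close>

lemma card_rich_fibres:
  assumes "finite E" "E \<noteq> {}" "G \<subseteq> tuples E (Suc j)" "\<eta> > 0"
    and "real (card G) \<ge> \<eta> * real (card E) ^ Suc j"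
  shows "real (card {z \<in> tuples E j. real (card {x \<in> E. x # z \<in> G}) \<ge> \<eta> / 2 * card E})
           \<ge> \<eta> / 2 * real (card E) ^ j"
    (is "real (card ?R) \<ge> _")
proof -
  let ?L = "tuples E j"
  have fin: "finite ?L" using assms by (simp add: finite_lists_length_eq)
  have cE: "real (card E) > 0" using assms by (simp add: card_gt_0_iff)
  have "G = (\<lambda>(z, x). x # z) ` (SIGMA z:?L. {x \<in> E. x # z \<in> G})"
  proof (intro equalityI subsetI)
    fix xs assume "xs \<in> G"
    moreover from this obtain x z where "xs = x # z" "x \<in> E" "z \<in> ?L"
      using assms(3) by (cases xs) auto
    ultimately show "xs \<in> (\<lambda>(z, x). x # z) ` (SIGMA z:?L. {x \<in> E. x # z \<in> G})"
      by (auto intro!: image_eqI[where x = "(z, x)"])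
  qed auto
  then have "card G = card ((\<lambda>(z, x). x # z) ` (SIGMA z:?L. {x \<in> E. x # z \<in> G}))" by simp
  also have "\<dots> = card (SIGMA z:?L. {x \<in> E. x # z \<in> G})"
    by (intro card_image) (auto simp: inj_on_def)
  also have "\<dots> = (\<Sum>z\<in>?L. card {x \<in> E. x # z \<in> G})"
    by (intro card_SigmaI) (use fin assms in auto)
  finally have "real (card G) = (\<Sum>z\<in>?L. real (card {x \<in> E. x # z \<in> G}))" by simp
  also have "\<dots> \<le> (\<Sum>z\<in>?L. (if z \<in> ?R then real (card E) else 0) + \<eta> / 2 * card E)"
  proof (intro sum_mono)
    fix z assume "z \<in> ?L"
    have "card {x \<in> E. x # z \<in> G} \<le> card E" by (intro card_mono) (use assms in auto)
    moreover have "0 \<le> \<eta> / 2 * card E" using assms by simp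
    ultimately show "real (card {x \<in> E. x # z \<in> G}) \<le> (if z \<in> ?R then real (card E) else 0) + \<eta> / 2 * card E"
      using \<open>z \<in> ?L\<close> by auto
  qed
  also have "\<dots> = real (card ?R) * card E + \<eta> / 2 * card E * card ?L"
    using fin by (simp add: sum.distrib sum.If_cases Int_def conj_ac)
  also have "real (card ?L) = real (card E) ^ j"
    using assms by (simp add: card_lists_length_eq)
  finally have "\<eta> / 2 * real (card E) ^ j * real (card E) \<le> real (card ?R) * card E"
    using assms(5) by (simp add: field_simps)
  then show ?thesis using cE by simp
qed

text \<open>Induction on the number of vertices, for all dense families at once, since the surviving
  bases are only a subfamily of all tuples. A base survives if it has many extensions in
  \<open>G\<close> and few star collisions; it then carries many stars.\<close>

lemma card_tuple_types_ge:
  assumes "finite E" "E \<noteq> {}" "q > 0"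
    and energy: "\<And>i. 1 \<le> i \<Longrightarrow> i \<le> j \<Longrightarrow>
      q ^ i * (\<Sum>p\<in>E \<times> E. real (agreement E D p) ^ i) \<le> 2 * real (card E) ^ (i + 2)"
    and "\<eta> > 0" "G \<subseteq> tuples E (Suc j)" "real (card G) \<ge> \<eta> * real (card E) ^ Suc j"
  shows "real (card (tuple_type D ` G)) \<ge> simplex_density j \<eta> * q ^ (Suc j choose 2)"
  using assms(4-)
proof (induction j arbitrary: \<eta> G)
  case 0
  \<comment> \<open>A single vertex has no dot products and \<open>1 choose 2 = 0\<close>, so it is
    enough that \<open>G\<close> is nonempty.\<close>
  have "card E > 0" using assms by (simp add: card_gt_0_iff)
  then have "\<eta> * real (card E) ^ Suc 0 > 0" using 0 by simp
  then have "real (card G) > 0" using "0.prems" by linarith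
  then have "card (tuple_type D ` G) \<noteq> 0" by (auto simp: card_gt_0_iff)
  then show ?case by (simp add: numeral_2_eq_2)
next
  case (Suc j)
  define m where "m = real (card E)"
  define Q where "Q = q ^ Suc j"
  define M where "M = m ^ Suc j"
  define L where "L = tuples E (Suc j)"
  \<comment> \<open>\<open>R\<close> holds the bases with many extensions, \<open>B\<close> those
    with too many collisions. The threshold in \<open>B\<close> is chosen so that Markov's
    inequality leaves at most \<open>\<eta> / 4 * M\<close> such bases, half of the guaranteed size
    of \<open>R\<close>.\<close>
  define R where "R = {z \<in> L. real (card {x \<in> E. x # z \<in> G}) \<ge> \<eta> / 2 * m}"
  define B where "B = {z \<in> L. star_collisions E D z > 8 / \<eta> * m\<^sup>2 / Q}"
  have m: "m > 0" using assms by (simp add: m_def card_gt_0_iff)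
  have Q: "Q > 0" using assms by (simp add: Q_def)
  have eta: "\<eta> > 0" by (rule Suc.prems)
  have fin: "finite L" using assms by (simp add: L_def finite_lists_length_eq)
  have finB: "finite B" and finR: "finite R" using fin by (auto simp: B_def R_def)
  have finG: "finite G"
    using Suc.prems(3) assms(1) by (rule finite_subset[OF _ finite_lists_length_eq])
  have R: "real (card R) \<ge> \<eta> / 2 * M"
    unfolding R_def L_def m_def M_def
    by (rule card_rich_fibres) (use assms Suc.prems in auto)
  \<comment> \<open>Markov's inequality for the collision counts, whose total over \<open>L\<close>
    is the moment of order \<open>Suc j\<close>.\<close>
  have "card B * (8 / \<eta> * m\<^sup>2 / Q) \<le> (\<Sum>z\<in>B. real (star_collisions E D z))"
    using sum_bounded_below[of B "8 / \<eta> * m\<^sup>2 / Q" "\<lambda>z. real (star_collisions E D z)"]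
    by (force simp: B_def)
  also have "\<dots> \<le> (\<Sum>z\<in>L. real (star_collisions E D z))"
    by (intro sum_mono2) (use fin in \<open>auto simp: B_def\<close>)
  also have "\<dots> = real (\<Sum>z\<in>L. star_collisions E D z)" by simp
  also have "\<dots> = (\<Sum>p\<in>E \<times> E. real (agreement E D p) ^ Suc j)"
    unfolding L_def sum_star_collisions[OF assms(1)] by simp
  finally have "Q * (card B * (8 / \<eta> * m\<^sup>2 / Q)) \<le> Q * (\<Sum>p\<in>E \<times> E. real (agreement E D p) ^ Suc j)"
    using Q by (intro mult_left_mono) auto
  also have "\<dots> \<le> 2 * m ^ (Suc j + 2)"
    unfolding Q_def m_def by (rule Suc.prems) auto
  also have "\<dots> = 2 * M * m\<^sup>2" by (simp add: M_def power_add power2_eq_square)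
  also have "Q * (card B * (8 / \<eta> * m\<^sup>2 / Q)) = card B * (8 / \<eta>) * m\<^sup>2"
    using Q by simp
  finally have "card B * (8 / \<eta>) \<le> 2 * M"
    by (rule mult_right_le_imp_le) (use m in simp)
  then have B: "card B \<le> \<eta> / 4 * M"
    using eta by (simp add: field_simps)
  define G' where "G' = R - B"
  have "card R - card B \<le> card G'" unfolding G'_def by (rule diff_card_le_card_Diff) fact
  then have card_G': "real (card G') \<ge> \<eta> / 4 * M" using R B by linarith
  have "real (card (tuple_type D ` G)) \<ge> \<eta> ^ 3 / 32 * Q * real (card (tuple_type D ` G'))"
  proof (rule card_cons_stars)
    fix z assume z: "z \<in> G'"
    let ?X = "{x \<in> E. x # z \<in> G}"
    let ?S = "(\<lambda>x. map (D x) z) ` ?X"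
    have X: "real (card ?X) \<ge> \<eta> / 2 * m" and
      c: "real (star_collisions E D z) \<le> 8 / \<eta> * m\<^sup>2 / Q"
      using z by (auto simp: G'_def R_def B_def)
    \<comment> \<open>Cauchy-Schwarz for the star map on the extensions of \<open>z\<close>: the
      square of at least \<open>\<eta> / 2 * m\<close>, divided by at most
      \<open>8 / \<eta> * m\<^sup>2 / Q\<close> collisions, leaves
      \<open>\<eta> ^ 3 / 32 * Q\<close> stars.\<close>
    have "(card ?X)\<^sup>2 \<le> card ?S * card {p \<in> ?X \<times> ?X. map (D (fst p)) z = map (D (snd p)) z}"
      by (rule card_power2_le_image_times_collisions) (use assms in auto)
    also have "\<dots> \<le> card ?S * star_collisions E D z"
      unfolding star_collisions_def by (intro mult_left_mono card_mono) (use assms in auto)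
    finally have energy_z: "(real (card ?X))\<^sup>2 \<le> real (card ?S) * real (star_collisions E D z)"
      by (simp only: of_nat_mult[symmetric] of_nat_power[symmetric] of_nat_le_iff)
    have "(\<eta> / 2)\<^sup>2 * m\<^sup>2 = (\<eta> / 2 * m)\<^sup>2" by (rule power_mult_distrib[symmetric])
    also have "\<dots> \<le> (real (card ?X))\<^sup>2"
      by (rule power_mono[OF X]) (use eta m in simp)
    also note energy_z
    also have "real (card ?S) * real (star_collisions E D z) \<le> real (card ?S) * (8 / \<eta> * m\<^sup>2 / Q)"
      by (intro mult_left_mono c) auto
    also have "\<dots> = real (card ?S) * (8 / \<eta> / Q) * m\<^sup>2" by simp
    finally have "(\<eta> / 2)\<^sup>2 \<le> real (card ?S) * (8 / \<eta> / Q)"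
      by (rule mult_right_le_imp_le) (use m in simp)
    then have "Q * (\<eta> / 8) * (\<eta> / 2)\<^sup>2 \<le> Q * (\<eta> / 8) * (real (card ?S) * (8 / \<eta> / Q))"
      by (rule mult_left_mono) (use eta Q in simp)
    also have "\<dots> = real (card ?S)" using eta Q by simp
    also have "Q * (\<eta> / 8) * (\<eta> / 2)\<^sup>2 = \<eta> ^ 3 / 32 * Q"
      by (simp add: power2_eq_square power3_eq_cube)
    finally show "\<eta> ^ 3 / 32 * Q \<le> real (card ?S)" .
  next
    show "finite G'" using finR by (simp add: G'_def)
  qed (fact finG assms)+
  moreover have IH: "real (card (tuple_type D ` G')) \<ge> simplex_density j (\<eta> / 4) * q ^ (Suc j choose 2)"
  proof (rule Suc.IH)
    show "real (card G') \<ge> \<eta> / 4 * real (card E) ^ Suc j"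
      using card_G' by (simp only: M_def m_def)
    show "G' \<subseteq> tuples E (Suc j)" by (auto simp: G'_def R_def L_def)
    show "\<eta> / 4 > 0" using eta by simp
  qed (rule Suc.prems(1), simp_all)
  have "\<eta> ^ 3 / 32 * Q * (simplex_density j (\<eta> / 4) * q ^ (Suc j choose 2))
      \<le> \<eta> ^ 3 / 32 * Q * real (card (tuple_type D ` G'))"
    by (rule mult_left_mono[OF IH]) (use eta Q in simp)
  moreover have "Suc (Suc j) choose 2 = Suc j + (Suc j choose 2)"
    by (simp add: numeral_2_eq_2)
  then have "simplex_density (Suc j) \<eta> * q ^ (Suc (Suc j) choose 2)
      = \<eta> ^ 3 / 32 * Q * (simplex_density j (\<eta> / 4) * q ^ (Suc j choose 2))"
    by (simp only: simplex_density.simps Q_def power_add mult_ac)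
  ultimately show ?case by linarith
qed

section \<open>Additive characters of residue vectors\<close>

text \<open>The standard additive character modulo \<open>n\<close>, taken on all integers so that
  sums and products of residues need no reduction.\<close>

definition add_char :: "nat \<Rightarrow> int \<Rightarrow> complex"
  where "add_char n a = cis (2 * pi * real_of_int a / real n)"

lemma add_char_0 [simp]: "add_char n 0 = 1"
  by (simp add: add_char_def)

lemma add_char_add: "add_char n (a + b) = add_char n a * add_char n b"
  by (simp add: add_char_def cis_mult distrib_left add_divide_distrib)

lemma norm_add_char [simp]: "norm (add_char n a) = 1"
  by (simp add: add_char_def)

lemma cnj_add_char: "cnj (add_char n a) = add_char n (- a)"
  by (simp add: add_char_def cis_cnj)

lemma add_char_power: "add_char n a ^ k = add_char n (int k * a)"
  by (simp add: add_char_def DeMoivre mult_ac)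

lemma add_char_sum: "add_char n (\<Sum>i\<in>I. f i) = (\<Prod>i\<in>I. add_char n (f i))"
  by (induction I rule: infinite_finite_induct) (auto simp: add_char_add)

lemma add_char_eq_1_iff:
  assumes "n > 0"
  shows "add_char n a = 1 \<longleftrightarrow> int n dvd a"
proof -
  have "add_char n a = 1 \<longleftrightarrow> (\<exists>k. 2 * pi * real_of_int a / real n = of_int k * (2 * pi))"
    unfolding add_char_def by (rule cis_eq_1_iff)
  also have "\<dots> \<longleftrightarrow> (\<exists>k. a = int n * k)"
  proof (rule ex_cong1)
    fix k
    have "2 * pi * real_of_int a / real n = of_int k * (2 * pi) \<longleftrightarrow> real_of_int a = real n * of_int k"
      using assms by (auto simp: field_simps)
    also have "\<dots> \<longleftrightarrow> real_of_int a = real_of_int (int n * k)" by simp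
    also have "\<dots> \<longleftrightarrow> a = int n * k" by (rule of_int_eq_iff)
    finally show "2 * pi * real_of_int a / real n = of_int k * (2 * pi) \<longleftrightarrow> a = int n * k" .
  qed
  finally show ?thesis by (auto simp: dvd_def)
qed

text \<open>Orthogonality of characters: a geometric series whose ratio is an \<open>n\<close>-th
  root of unity.\<close>

lemma sum_add_char:
  assumes "n > 0"
  shows "(\<Sum>s\<in>{0..<int n}. add_char n (s * a)) = (if int n dvd a then of_nat n else 0)"
proof -
  have "(\<Sum>s\<in>{0..<int n}. add_char n (s * a)) = (\<Sum>s<n. add_char n (int s * a))"
    by (rule sum.reindex_bij_witness[where i = int and j = nat]) auto
  also have "\<dots> = (\<Sum>s<n. add_char n a ^ s)" by (simp add: add_char_power)
  finally have eq: "(\<Sum>s\<in>{0..<int n}. add_char n (s * a)) = (\<Sum>s<n. add_char n a ^ s)" .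
  show ?thesis
  proof (cases "int n dvd a")
    case True
    then have "add_char n a = 1" using add_char_eq_1_iff[OF assms] by simp
    then show ?thesis using True by (simp add: eq)
  next
    case False
    have "(1 - add_char n a) * (\<Sum>s<n. add_char n a ^ s) = 1 - add_char n a ^ n"
      by (rule one_diff_power_eq[symmetric])
    also have "add_char n a ^ n = 1"
      using assms by (simp add: add_char_power add_char_eq_1_iff)
    finally show ?thesis
      using False add_char_eq_1_iff[OF assms, of a] by (auto simp: eq)
  qed
qed

section \<open>Dot products over the integers and orthogonality on residue vectors\<close>

text \<open>The integer lift of the dot product. It is bilinear without reduction modulo
  \<open>n\<close> and also accepts differences and shifts of residue vectors.\<close>

definition int_dot :: "nat \<Rightarrow> (nat \<Rightarrow> int) \<Rightarrow> (nat \<Rightarrow> int) \<Rightarrow> int"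
  where "int_dot d x y = (\<Sum>i\<in>{1..d}. x i * y i)"

lemma carrier_Zn: "carrier (Zn n) = {0..<int n}"
  by (auto simp: residue_ring_def)

lemma finite_Zn_vectors: "finite (Zn_vectors n d)"
  unfolding Zn_vectors_def carrier_Zn by (intro finite_PiE) auto

lemma finsum_residue_ring:
  assumes "m > 1" "finite I" "f \<in> I \<rightarrow> carrier (residue_ring m)"
  shows "finsum (residue_ring m) f I = (\<Sum>i\<in>I. f i) mod m"
proof -
  interpret residues m "residue_ring m" using assms(1) by unfold_locales
  interpret cring "residue_ring m" by (rule cring)
  from assms(2,3) show ?thesis
  proof (induction I rule: finite_induct)
    case (insert i I)
    then have "finsum (residue_ring m) f (insert i I) = f i \<oplus>\<^bsub>residue_ring m\<^esub> finsum (residue_ring m) f I"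
      by (intro finsum_insert) auto
    also have "\<dots> = (f i + (\<Sum>i\<in>I. f i) mod m) mod m"
      using insert by (subst insert.IH) (auto simp: residue_ring_def)
    finally show ?case using insert by (simp add: mod_add_right_eq)
  next
    case empty
    show ?case by (simp only: finsum_empty) (simp add: residue_ring_def)
  qed
qed

lemma dot_product_eq:
  assumes "n > 1"
  shows "dot_product n d x y = int_dot d x y mod int n"
proof -
  have "dot_product n d x y = (\<Sum>i\<in>{1..d}. x i \<otimes>\<^bsub>Zn n\<^esub> y i) mod int n"
    unfolding dot_product_def
    by (intro finsum_residue_ring) (use assms in \<open>auto simp: residue_ring_def\<close>)
  then show ?thesis by (simp add: residue_ring_def int_dot_def mod_sum_eq)
qed

text \<open>The character of a dot product is a product over coordinates, so orthogonality applies
  in each coordinate separately.\<close>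

lemma sum_add_char_vectors:
  assumes "n > 0"
  shows "(\<Sum>z\<in>Zn_vectors n d. add_char n (int_dot d z w))
    = (if \<forall>i\<in>{1..d}. int n dvd w i then of_nat n ^ d else 0)"
proof -
  have "(\<Sum>z\<in>Zn_vectors n d. add_char n (int_dot d z w))
      = (\<Sum>z\<in>{1..d} \<rightarrow>\<^sub>E {0..<int n}. \<Prod>i\<in>{1..d}. add_char n (z i * w i))"
    by (simp add: Zn_vectors_def carrier_Zn int_dot_def add_char_sum)
  also have "\<dots> = (\<Prod>i\<in>{1..d}. \<Sum>a\<in>{0..<int n}. add_char n (a * w i))"
    by (subst prod_sum_PiE) auto
  also have "\<dots> = (\<Prod>i\<in>{1..d}. if int n dvd w i then of_nat n else 0)"
    using assms by (simp add: sum_add_char)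
  also have "\<dots> = (if \<forall>i\<in>{1..d}. int n dvd w i then of_nat n ^ d else 0)"
    by auto
  finally show ?thesis .
qed

section \<open>Counting solutions of linear congruences\<close>

text \<open>Put \<open>g = gcd s (int n)\<close> and \<open>h = int n div g\<close>. As
  \<open>s div g\<close> is coprime to \<open>h\<close>, all solutions lie in one residue class
  modulo \<open>h\<close>, so they are told apart by \<open>b div h\<close>, which takes at most
  \<open>g\<close> values.\<close>

lemma card_congruent_residues_le:
  assumes "n > 0"
  shows "card {b \<in> {0..<int n}. int n dvd s * (a - b)} \<le> nat (gcd s (int n))"
proof -
  define g where "g = gcd s (int n)"
  define h where "h = int n div g"
  have g: "g > 0" using assms by (simp add: g_def)
  have n: "int n = g * h" by (simp add: h_def g_def)
  have h: "h > 0" using n g assms by (metis of_nat_0_less_iff zero_less_mult_pos)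
  have *: "h dvd a - b" if "int n dvd s * (a - b)" for b
  proof -
    have "s = g * (s div g)" by (simp add: g_def)
    then have "g * h dvd g * ((s div g) * (a - b))" using that n by (metis mult.assoc)
    then have "h dvd (s div g) * (a - b)" using g by simp
    moreover have "coprime (s div g) h"
      unfolding h_def g_def using assms by (intro div_gcd_coprime) auto
    ultimately show ?thesis by (metis coprime_commute coprime_dvd_mult_right_iff)
  qed
  have "card {b \<in> {0..<int n}. int n dvd s * (a - b)} \<le> card {0..<g}"
  proof (rule card_inj_on_le)
    show "inj_on (\<lambda>b. b div h) {b \<in> {0..<int n}. int n dvd s * (a - b)}"
    proof (rule inj_onI, clarify)
      fix b c assume b: "int n dvd s * (a - b)" and c: "int n dvd s * (a - c)" and "b div h = c div h"
      have "h dvd (a - b) - (a - c)" using *[OF b] *[OF c] by (rule dvd_diff)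
      then have "h dvd c - b" by simp
      then have "b mod h = c mod h" by (metis mod_eq_dvd_iff)
      with \<open>b div h = c div h\<close> show "b = c" by (metis div_mult_mod_eq)
    qed
    show "(\<lambda>b. b div h) ` {b \<in> {0..<int n}. int n dvd s * (a - b)} \<subseteq> {0..<g}"
    proof clarify
      fix b assume "b \<in> {0..<int n}"
      moreover have "b div h * h \<le> b" using h by (simp add: minus_mod_eq_div_mult[symmetric])
      ultimately have "b div h * h < g * h" by (simp add: n)
      then have "b div h < g" using h by simp
      moreover have "0 \<le> b div h" using h \<open>b \<in> {0..<int n}\<close> by (simp add: pos_imp_zdiv_nonneg_iff)
      ultimately show "b div h \<in> {0..<g}" by simp
    qed
  qed simp
  then show ?thesis by (simp add: g_def)
qed

lemma card_congruent_vectors_le: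
  assumes "n > 0" "E \<subseteq> Zn_vectors n d"
  shows "card {y \<in> E. \<forall>i\<in>{1..d}. int n dvd s * (x i - y i)} \<le> nat (gcd s (int n)) ^ d"
proof -
  let ?F = "PiE {1..d} (\<lambda>i. {b \<in> {0..<int n}. int n dvd s * (x i - b)})"
  have "finite {b \<in> {0..<int n}. int n dvd s * (x i - b)}" for i
    by (rule finite_subset[of _ "{0..<int n}"]) auto
  then have "finite ?F" by (intro finite_PiE) simp_all
  moreover have "{y \<in> E. \<forall>i\<in>{1..d}. int n dvd s * (x i - y i)} \<subseteq> ?F"
    using assms(2) by (auto simp: Zn_vectors_def carrier_Zn PiE_iff subset_eq)
  ultimately have "card {y \<in> E. \<forall>i\<in>{1..d}. int n dvd s * (x i - y i)} \<le> card ?F"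
    by (rule card_mono)
  also have "\<dots> = (\<Prod>i\<in>{1..d}. card {b \<in> {0..<int n}. int n dvd s * (x i - b)})"
    by (rule card_PiE) simp
  also have "\<dots> \<le> (\<Prod>i\<in>{1..d}. nat (gcd s (int n)))"
    by (intro prod_mono conjI card_congruent_residues_le assms) simp
  finally show ?thesis by simp
qed

section \<open>Fourier coefficients of a set in mean square\<close>

text \<open>The unnormalised Fourier transform of the indicator function of \<open>E\<close>, up to
  the sign convention for the frequency.\<close>

definition char_sum :: "nat \<Rightarrow> nat \<Rightarrow> (nat \<Rightarrow> int) set \<Rightarrow> (nat \<Rightarrow> int) \<Rightarrow> complex"
  where "char_sum n d E m = (\<Sum>x\<in>E. add_char n (int_dot d m x))"

definition pair_diff :: "(nat \<Rightarrow> int) \<times> (nat \<Rightarrow> int) \<Rightarrow> nat \<Rightarrow> int"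
  where "pair_diff p i = fst p i - snd p i"

lemma int_dot_add: "int_dot d (\<lambda>i. x i + y i) w = int_dot d x w + int_dot d y w"
  by (simp add: int_dot_def distrib_right sum.distrib)

lemma int_dot_diff: "int_dot d z (pair_diff p) = int_dot d z (fst p) - int_dot d z (snd p)"
  by (simp add: int_dot_def pair_diff_def right_diff_distrib sum_subtractf)

lemma int_dot_scale: "int_dot d (\<lambda>i. s * z i) w = s * int_dot d z w"
  by (simp add: int_dot_def sum_distrib_left mult_ac)

lemma int_dot_scale_right: "int_dot d z (\<lambda>i. s * w i) = s * int_dot d z w"
  by (simp add: int_dot_def sum_distrib_left mult_ac)

lemma int_dot_commute: "int_dot d z w = int_dot d w z"
  by (simp add: int_dot_def mult_ac)

lemma norm_char_sum_power2:
  "of_real ((norm (char_sum n d E m))\<^sup>2) = (\<Sum>p\<in>E \<times> E. add_char n (int_dot d m (pair_diff p)))"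
proof -
  have "of_real ((norm (char_sum n d E m))\<^sup>2) = char_sum n d E m * cnj (char_sum n d E m)"
    by (rule complex_norm_square)
  also have "\<dots> = (\<Sum>x\<in>E. \<Sum>y\<in>E. add_char n (int_dot d m x) * add_char n (- int_dot d m y))"
    by (simp add: char_sum_def cnj_add_char sum_product)
  also have "\<dots> = (\<Sum>p\<in>E \<times> E. add_char n (int_dot d m (pair_diff p)))"
    by (simp add: sum.cartesian_product int_dot_diff add_char_add[symmetric] case_prod_beta)
  finally show ?thesis .
qed

text \<open>After expanding the squares and summing over \<open>z\<close>, orthogonality keeps only
  the pairs with \<open>n\<close> dividing \<open>s * (x i - y i)\<close> in every coordinate, and
  the congruence count bounds the \<open>y\<close> for each \<open>x\<close>. The shift
  \<open>m\<close> contributes only factors of modulus one, so the bound is uniform in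
  \<open>m\<close>.\<close>

lemma sum_norm_char_sum_le:
  assumes "n > 0" "E \<subseteq> Zn_vectors n d"
  shows "(\<Sum>z\<in>Zn_vectors n d. (norm (char_sum n d E (\<lambda>i. m i + s * z i)))\<^sup>2)
    \<le> real n ^ d * real (card E) * real (nat (gcd s (int n))) ^ d"
proof -
  have finE: "finite E" using assms(2) finite_Zn_vectors by (rule finite_subset)
  let ?V = "Zn_vectors n d"
  define P where "P = {p \<in> E \<times> E. \<forall>i\<in>{1..d}. int n dvd s * pair_diff p i}"
  have "complex_of_real (\<Sum>z\<in>?V. (norm (char_sum n d E (\<lambda>i. m i + s * z i)))\<^sup>2)
      = (\<Sum>z\<in>?V. \<Sum>p\<in>E \<times> E. add_char n (int_dot d (\<lambda>i. m i + s * z i) (pair_diff p)))"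
    by (simp add: norm_char_sum_power2 del: of_real_power)
  also have "\<dots> = (\<Sum>p\<in>E \<times> E. \<Sum>z\<in>?V. add_char n (int_dot d (\<lambda>i. m i + s * z i) (pair_diff p)))"
    by (rule sum.swap)
  also have "\<dots> = (\<Sum>p\<in>E \<times> E. add_char n (int_dot d m (pair_diff p)) *
      (\<Sum>z\<in>?V. add_char n (int_dot d z (\<lambda>i. s * pair_diff p i))))"
    by (simp add: int_dot_add int_dot_scale int_dot_scale_right add_char_add sum_distrib_left)
  also have "\<dots> = (\<Sum>p\<in>E \<times> E. if p \<in> P then add_char n (int_dot d m (pair_diff p)) * of_nat n ^ d else 0)"
    unfolding sum_add_char_vectors[OF assms(1)] by (intro sum.cong refl) (simp add: P_def)
  finally have eq: "complex_of_real (\<Sum>z\<in>?V. (norm (char_sum n d E (\<lambda>i. m i + s * z i)))\<^sup>2) = \<dots>" .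
  have "(\<Sum>z\<in>?V. (norm (char_sum n d E (\<lambda>i. m i + s * z i)))\<^sup>2)
      \<le> norm (complex_of_real (\<Sum>z\<in>?V. (norm (char_sum n d E (\<lambda>i. m i + s * z i)))\<^sup>2))"
    unfolding norm_of_real by (rule abs_ge_self)
  also have "\<dots> \<le> (\<Sum>p\<in>E \<times> E. if p \<in> P then real n ^ d else 0)"
    unfolding eq by (rule sum_norm_le) (simp add: norm_mult norm_power)
  also have "\<dots> = real (card P) * real n ^ d"
    using finE by (simp add: sum.If_cases P_def Int_def)
  also have "card P = card (SIGMA x:E. {y \<in> E. \<forall>i\<in>{1..d}. int n dvd s * (x i - y i)})"
    by (rule arg_cong[where f = card]) (auto simp: P_def pair_diff_def)
  also have "\<dots> = (\<Sum>x\<in>E. card {y \<in> E. \<forall>i\<in>{1..d}. int n dvd s * (x i - y i)})"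
    using finE by simp
  also have "real \<dots> \<le> real (\<Sum>x\<in>E. nat (gcd s (int n)) ^ d)"
    by (intro of_nat_mono sum_mono card_congruent_vectors_le assms)
  finally show ?thesis by (simp add: mult_ac mult_right_mono)
qed

section \<open>Sums of greatest common divisors\<close>

text \<open>For \<open>0 < s < n\<close> the gcd is a proper divisor of \<open>n\<close>, so its
  cofactor has a prime factor, which is at least \<open>least_prime_divisor n\<close>.\<close>

lemma gcd_le_div_least_prime:
  assumes "s \<in> {1..<int n}"
  shows "real (nat (gcd s (int n))) \<le> real n / real (least_prime_divisor n)"
    and "least_prime_divisor n > 0"
proof -
  define g where "g = nat (gcd s (int n))"
  define h where "h = n div g"
  have n: "n > 0" using assms by auto
  have int_g: "int g = gcd s (int n)" by (simp add: g_def)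
  then have "int g dvd int n" "int g dvd s" by simp_all
  then have gh: "n = g * h" by (simp add: h_def)
  have "int g \<le> s" using \<open>int g dvd s\<close> assms by (intro zdvd_imp_le) auto
  then have "g < n" using assms by simp
  then have "h \<noteq> 1" using gh by auto
  then obtain p where p: "prime p" "p dvd h" using prime_factor_nat by blast
  then have pn: "prime p \<and> p dvd n" using gh by simp
  have "prime (least_prime_divisor n) \<and> least_prime_divisor n dvd n"
    unfolding least_prime_divisor_def using pn by (rule LeastI)
  then show pos: "least_prime_divisor n > 0" by (simp add: prime_gt_0_nat)
  have "least_prime_divisor n \<le> p"
    unfolding least_prime_divisor_def using pn by (rule Least_le)
  also have "p \<le> h" using p gh n by (intro dvd_imp_le) auto
  finally have "g * least_prime_divisor n \<le> n" by (subst gh) simp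
  then have "real g * real (least_prime_divisor n) \<le> real n"
    by (metis of_nat_le_iff of_nat_mult)
  then show "real (nat (gcd s (int n))) \<le> real n / real (least_prime_divisor n)"
    using pos by (simp add: g_def pos_le_divide_eq)
qed

text \<open>The gcd is at most the sum of all common divisors of \<open>s\<close> and
  \<open>n\<close>. After exchanging the sums, each divisor \<open>g\<close> of \<open>n\<close> has
  at most \<open>n div g\<close> multiples \<open>s\<close> in the range, so it contributes at most
  \<open>n\<close>.\<close>

lemma sum_gcd_le:
  assumes "n > 0"
  shows "(\<Sum>s\<in>{1..<int n}. real (nat (gcd s (int n)))) \<le> real (num_divisors n) * real n"
proof -
  let ?G = "{g. g dvd n}"
  have fin: "finite ?G" using assms by simp
  have "(\<Sum>s\<in>{1..<int n}. nat (gcd s (int n)))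
      \<le> (\<Sum>s\<in>{1..<int n}. \<Sum>g\<in>?G. if int g dvd s then g else 0)"
  proof (rule sum_mono)
    fix s assume "s \<in> {1..<int n}"
    define g where "g = nat (gcd s (int n))"
    have int_g: "int g = gcd s (int n)" by (simp add: g_def)
    then have "int g dvd int n" "int g dvd s" by simp_all
    then have "g = (if int g dvd s then g else 0)" "g \<in> ?G" by simp_all
    then have "g \<le> (\<Sum>g\<in>?G. if int g dvd s then g else 0)"
      using fin member_le_sum[of g ?G "\<lambda>g. if int g dvd s then g else 0"] by simp
    then show "nat (gcd s (int n)) \<le> (\<Sum>g\<in>?G. if int g dvd s then g else 0)"
      by (simp add: g_def)
  qed
  also have "\<dots> = (\<Sum>g\<in>?G. \<Sum>s\<in>{1..<int n}. if int g dvd s then g else 0)"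
    by (rule sum.swap)
  also have "\<dots> = (\<Sum>g\<in>?G. card {s \<in> {1..<int n}. int g dvd s} * g)"
    by (simp add: sum.If_cases Int_def)
  also have "\<dots> \<le> (\<Sum>g\<in>?G. n)"
  proof (rule sum_mono)
    fix g assume "g \<in> ?G"
    then have gn: "n = n div g * g" and g: "g > 0" using assms by (auto simp: dvd_pos_nat)
    have "{s \<in> {1..<int n}. int g dvd s} \<subseteq> (\<lambda>k. int g * k) ` {1..int (n div g)}"
    proof
      fix s assume s: "s \<in> {s \<in> {1..<int n}. int g dvd s}"
      then obtain k where k: "s = int g * k" by auto
      have "int g * k > 0" using s k by simp
      then have "k > 0" using g by (simp add: zero_less_mult_iff)
      moreover have "int g * k < int g * int (n div g)"
        using s k gn by (metis (no_types, lifting) atLeastLessThan_iff mem_Collect_eq mult.commute of_nat_mult)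
      then have "k < int (n div g)" using g by (simp add: mult_less_cancel_left_pos)
      ultimately show "s \<in> (\<lambda>k. int g * k) ` {1..int (n div g)}" using k by auto
    qed
    then have "card {s \<in> {1..<int n}. int g dvd s} \<le> card ((\<lambda>k. int g * k) ` {1..int (n div g)})"
      by (intro card_mono) auto
    also have "\<dots> \<le> card {1..int (n div g)}" by (rule card_image_le) simp
    finally have "card {s \<in> {1..<int n}. int g dvd s} * g \<le> n div g * g" by simp
    then show "card {s \<in> {1..<int n}. int g dvd s} * g \<le> n" using gn by simp
  qed
  also have "\<dots> = num_divisors n * n" by (simp add: num_divisors_def)
  finally have "real (\<Sum>s\<in>{1..<int n}. nat (gcd s (int n))) \<le> real (num_divisors n * n)"
    by (rule of_nat_mono)
  then show ?thesis by simp
qed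

text \<open>One factor of the gcd goes into the divisor sum; the other \<open>d - 1\<close> are each
  bounded by \<open>n / least_prime_divisor n\<close>.\<close>

lemma sum_gcd_power_le:
  assumes "n > 0" "d \<ge> 1"
  shows "(\<Sum>s\<in>{1..<int n}. real (nat (gcd s (int n))) ^ d)
    \<le> real (num_divisors n) * real n * (real n / real (least_prime_divisor n)) ^ (d - 1)"
proof -
  let ?r = "real n / real (least_prime_divisor n)"
  have "(\<Sum>s\<in>{1..<int n}. real (nat (gcd s (int n))) ^ d)
      \<le> (\<Sum>s\<in>{1..<int n}. real (nat (gcd s (int n))) * ?r ^ (d - 1))"
  proof (rule sum_mono)
    fix s assume s: "s \<in> {1..<int n}"
    have "real (nat (gcd s (int n))) ^ d
        = real (nat (gcd s (int n))) * real (nat (gcd s (int n))) ^ (d - 1)"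
      using assms(2) by (cases d) auto
    also have "\<dots> \<le> real (nat (gcd s (int n))) * ?r ^ (d - 1)"
      by (intro mult_left_mono power_mono gcd_le_div_least_prime[OF s]) auto
    finally show "real (nat (gcd s (int n))) ^ d \<le> real (nat (gcd s (int n))) * ?r ^ (d - 1)" .
  qed
  also have "\<dots> = (\<Sum>s\<in>{1..<int n}. real (nat (gcd s (int n)))) * ?r ^ (d - 1)"
    by (rule sum_distrib_right[symmetric])
  also have "\<dots> \<le> real (num_divisors n) * real n * ?r ^ (d - 1)"
    by (intro mult_right_mono sum_gcd_le assms) auto
  finally show ?thesis .
qed

section \<open>Moments of the coincidence counts\<close>

text \<open>The parameter \<open>S\<close> covers two cases: over all frequencies this is
  \<open>n\<close> times the agreement count, over the nonzero ones it is the error term.\<close>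

definition freq_sum ::
    "nat \<Rightarrow> nat \<Rightarrow> (nat \<Rightarrow> int) set \<Rightarrow> int set \<Rightarrow> (nat \<Rightarrow> int) \<times> (nat \<Rightarrow> int) \<Rightarrow> complex"
  where "freq_sum n d E S p = (\<Sum>s\<in>S. \<Sum>z\<in>E. add_char n (s * int_dot d z (pair_diff p)))"

lemma freq_sum_full:
  assumes "n > 1" "finite E"
  shows "freq_sum n d E {0..<int n} p = of_nat n * of_nat (agreement E (dot_product n d) p)"
proof -
  have iff: "dot_product n d (fst p) z = dot_product n d (snd p) z
      \<longleftrightarrow> int n dvd int_dot d z (pair_diff p)" for z
    using assms by (simp add: dot_product_eq mod_eq_dvd_iff int_dot_diff int_dot_commute[of d z])
  have "freq_sum n d E {0..<int n} p
      = (\<Sum>z\<in>E. \<Sum>s\<in>{0..<int n}. add_char n (s * int_dot d z (pair_diff p)))"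
    unfolding freq_sum_def by (rule sum.swap)
  also have "\<dots> = (\<Sum>z\<in>E. if int n dvd int_dot d z (pair_diff p) then of_nat n else 0)"
    using assms by (simp add: sum_add_char)
  also have "\<dots> = of_nat n * of_nat (agreement E (dot_product n d) p)"
    using assms(2) by (simp add: sum.If_cases agreement_def iff Int_def)
  finally show ?thesis .
qed

lemma freq_sum_split:
  assumes "n > 0"
  shows "freq_sum n d E {0..<int n} p = of_nat (card E) + freq_sum n d E {1..<int n} p"
proof -
  have "{0..<int n} = insert 0 {1..<int n}" using assms by auto
  then show ?thesis by (simp add: freq_sum_def)
qed

text \<open>Multiplying by \<open>freq_sum\<close> replaces the frequency \<open>m\<close> by the
  shifts \<open>m i + s * z i\<close>. The weight \<open>f\<close> is carried along unchanged, so
  the step can be iterated.\<close>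

lemma twisted_freq_sum:
  "(\<Sum>p\<in>P. add_char n (int_dot d m (pair_diff p)) * f p * freq_sum n d E S p)
    = (\<Sum>s\<in>S. \<Sum>z\<in>E. \<Sum>p\<in>P. add_char n (int_dot d (\<lambda>i. m i + s * z i) (pair_diff p)) * f p)"
proof -
  have "(\<Sum>p\<in>P. add_char n (int_dot d m (pair_diff p)) * f p * freq_sum n d E S p)
      = (\<Sum>p\<in>P. \<Sum>s\<in>S. \<Sum>z\<in>E. add_char n (int_dot d (\<lambda>i. m i + s * z i) (pair_diff p)) * f p)"
    by (simp add: freq_sum_def sum_distrib_left int_dot_add int_dot_scale add_char_add mult_ac)
  also have "\<dots> = (\<Sum>s\<in>S. \<Sum>p\<in>P. \<Sum>z\<in>E. add_char n (int_dot d (\<lambda>i. m i + s * z i) (pair_diff p)) * f p)"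
    by (rule sum.swap)
  also have "\<dots> = (\<Sum>s\<in>S. \<Sum>z\<in>E. \<Sum>p\<in>P. add_char n (int_dot d (\<lambda>i. m i + s * z i) (pair_diff p)) * f p)"
    by (intro sum.cong refl sum.swap)
  finally show ?thesis .
qed

text \<open>Bounds the sum, over nonzero \<open>s\<close> and over \<open>z\<close> in
  \<open>E\<close>, of the squared Fourier coefficients at \<open>m i + s * z i\<close>, whatever
  \<open>m\<close> is.\<close>

definition error_bound :: "nat \<Rightarrow> nat \<Rightarrow> (nat \<Rightarrow> int) set \<Rightarrow> real"
  where "error_bound n d E
    = real n ^ d * real (card E) * (\<Sum>s\<in>{1..<int n}. real (nat (gcd s (int n))) ^ d)"

text \<open>Each full factor opens into \<open>n * card E\<close> shifts of the frequency, and the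
  triangle inequality costs exactly that factor. The claim is made for every \<open>m\<close>
  because the induction step changes \<open>m\<close>.\<close>

lemma norm_twisted_error_le:
  assumes "n > 0" "E \<subseteq> Zn_vectors n d"
  shows "norm (\<Sum>p\<in>E \<times> E. add_char n (int_dot d m (pair_diff p)) *
      (freq_sum n d E {0..<int n} p ^ j * freq_sum n d E {1..<int n} p))
    \<le> (real n * real (card E)) ^ j * error_bound n d E"
proof (induction j arbitrary: m)
  case 0
  let ?W = "\<lambda>s z. (norm (char_sum n d E (\<lambda>i. m i + s * z i)))\<^sup>2"
  \<comment> \<open>With no full factor left, the sum over pairs is a sum of squared moduli. These
    are nonnegative, so \<open>z\<close> may be allowed to range over the whole of
    \<open>Zn_vectors n d\<close>.\<close>
  have "(\<Sum>p\<in>E \<times> E. add_char n (int_dot d m (pair_diff p)) * freq_sum n d E {1..<int n} p)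
      = (\<Sum>s\<in>{1..<int n}. \<Sum>z\<in>E. complex_of_real (?W s z))"
    using twisted_freq_sum[of n d m "\<lambda>_. 1" E "{1..<int n}" "E \<times> E"]
    by (simp only: norm_char_sum_power2 mult_1_right)
  also have "\<dots> = complex_of_real (\<Sum>s\<in>{1..<int n}. \<Sum>z\<in>E. ?W s z)" by simp
  also have "norm \<dots> = (\<Sum>s\<in>{1..<int n}. \<Sum>z\<in>E. ?W s z)"
    unfolding norm_of_real by (intro abs_of_nonneg sum_nonneg) auto
  also have "\<dots> \<le> (\<Sum>s\<in>{1..<int n}. \<Sum>z\<in>Zn_vectors n d. ?W s z)"
    by (intro sum_mono sum_mono2 finite_Zn_vectors assms) auto
  also have "\<dots> \<le> (\<Sum>s\<in>{1..<int n}. real n ^ d * real (card E) * real (nat (gcd s (int n))) ^ d)"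
    by (intro sum_mono sum_norm_char_sum_le assms)
  also have "\<dots> = error_bound n d E" by (simp add: error_bound_def sum_distrib_left)
  finally show ?case by simp
next
  case (Suc j)
  let ?b = "(real n * real (card E)) ^ j * error_bound n d E"
  let ?K = "freq_sum n d E {0..<int n}" and ?R = "freq_sum n d E {1..<int n}"
  have "(\<Sum>p\<in>E \<times> E. add_char n (int_dot d m (pair_diff p)) * (?K p ^ Suc j * ?R p))
      = (\<Sum>p\<in>E \<times> E. add_char n (int_dot d m (pair_diff p)) * (?K p ^ j * ?R p) * ?K p)"
    by (simp add: mult_ac)
  also have "\<dots> = (\<Sum>s\<in>{0..<int n}. \<Sum>z\<in>E. \<Sum>p\<in>E \<times> E.
      add_char n (int_dot d (\<lambda>i. m i + s * z i) (pair_diff p)) * (?K p ^ j * ?R p))"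
    by (rule twisted_freq_sum)
  also have "norm \<dots> \<le> (\<Sum>s\<in>{0..<int n}. \<Sum>z\<in>E. ?b)"
    by (intro sum_norm_le Suc.IH)
  also have "\<dots> = (real n * real (card E)) ^ Suc j * error_bound n d E"
    by (simp add: mult_ac)
  finally show ?case .
qed

text \<open>One factor is split as \<open>card E\<close> plus the error: the first part lowers the
  power, the second is the twisted error with \<open>m = 0\<close>. Unwinding down to the power 0
  gives the main term, and each of the \<open>Suc j\<close> splittings adds one error term.\<close>

lemma norm_moment_le:
  assumes "n > 0" "E \<subseteq> Zn_vectors n d"
  shows "norm (\<Sum>p\<in>E \<times> E. freq_sum n d E {0..<int n} p ^ Suc j)
    \<le> real (card E) ^ (j + 3) + real (Suc j) * ((real n * real (card E)) ^ j * error_bound n d E)"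
proof (induction j)
  let ?K = "freq_sum n d E {0..<int n}" and ?R = "freq_sum n d E {1..<int n}"
  let ?e = "real (card E)"
  let ?B = "error_bound n d E"
  have B: "?B \<ge> 0" by (auto simp: error_bound_def intro!: mult_nonneg_nonneg sum_nonneg)
  have split: "norm (\<Sum>p\<in>E \<times> E. ?K p ^ Suc i)
      \<le> ?e * norm (\<Sum>p\<in>E \<times> E. ?K p ^ i) + (real n * ?e) ^ i * ?B" for i
  proof -
    have "(\<Sum>p\<in>E \<times> E. ?K p ^ Suc i) = (\<Sum>p\<in>E \<times> E. (of_nat (card E) + ?R p) * ?K p ^ i)"
      using freq_sum_split[OF assms(1), of d E] by simp
    also have "\<dots> = of_nat (card E) * (\<Sum>p\<in>E \<times> E. ?K p ^ i) + (\<Sum>p\<in>E \<times> E. ?K p ^ i * ?R p)"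
      by (simp add: distrib_left distrib_right mult_ac sum.distrib sum_distrib_left)
    finally have "norm (\<Sum>p\<in>E \<times> E. ?K p ^ Suc i)
        \<le> norm (of_nat (card E) * (\<Sum>p\<in>E \<times> E. ?K p ^ i)) + norm (\<Sum>p\<in>E \<times> E. ?K p ^ i * ?R p)"
      by (simp only: norm_triangle_ineq)
    moreover have "norm (\<Sum>p\<in>E \<times> E. ?K p ^ i * ?R p) \<le> (real n * ?e) ^ i * ?B"
      using norm_twisted_error_le[OF assms, of "\<lambda>_. 0" i] by (simp add: int_dot_def)
    ultimately show ?thesis by (simp add: norm_mult)
  qed
  case 0
  show ?case using split[of 0]
    by (simp add: norm_mult numeral_3_eq_3 card_cartesian_product)
  case (Suc j)
  let ?X = "(real n * ?e) ^ j * ?B"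
  have "norm (\<Sum>p\<in>E \<times> E. ?K p ^ Suc (Suc j))
      \<le> ?e * (?e ^ (j + 3) + real (Suc j) * ?X) + (real n * ?e) ^ Suc j * ?B"
    using split[of "Suc j"] mult_left_mono[OF Suc.IH, of ?e] by linarith
  \<comment> \<open>The inserted \<open>1\<close> is next raised to \<open>n\<close>, which gives
    the earlier error terms the same shape as the new one.\<close>
  also have "\<dots> = ?e ^ (Suc j + 3) + real (Suc j) * (1 * (?e * ?X)) + (real n * ?e) ^ Suc j * ?B"
    by (simp only: add_Suc power_Suc distrib_left mult_1_left mult_ac)
  also have "\<dots> \<le> ?e ^ (Suc j + 3) + real (Suc j) * (real n * (?e * ?X)) + (real n * ?e) ^ Suc j * ?B"
    using assms(1) B
    by (intro add_mono mult_left_mono mult_right_mono order_refl mult_nonneg_nonneg) auto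
  also have "\<dots> = ?e ^ (Suc j + 3) + real (Suc (Suc j)) * ((real n * ?e) ^ Suc j * ?B)"
    by (simp add: algebra_simps)
  finally show ?case .
qed

text \<open>\<open>large\<close> is the size hypothesis at order \<open>i\<close>, in squared form.
  It makes the error no larger than the main term, whence the factor 2.\<close>

lemma moment_agreement_le:
  assumes "n > 1" "d \<ge> 1" "E \<subseteq> Zn_vectors n d" "1 \<le> i"
    and large: "real i * (real (num_divisors n) * real n ^ (2 * d + i - 1) /
        real (least_prime_divisor n) ^ (d - 1)) \<le> (real (card E))\<^sup>2"
  shows "real n ^ i * (\<Sum>p\<in>E \<times> E. real (agreement E (dot_product n d) p) ^ i)
    \<le> 2 * real (card E) ^ (i + 2)"
proof -
  obtain j where i: "i = Suc j" using assms(4) by (cases i) auto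
  \<comment> \<open>The powers of \<open>n\<close> in the error: \<open>j\<close> from the full
    factors, \<open>d\<close> from summing over the module, 1 from the divisor sum and
    \<open>d - 1\<close> from the gcd bound.\<close>
  have expo: "2 * d + i - 1 = d + j + 1 + (d - 1)" using assms(2) by (simp add: i)
  let ?e = "real (card E)" and ?g = "real (least_prime_divisor n)" and ?t = "real (num_divisors n)"
  let ?S = "\<Sum>p\<in>E \<times> E. real (agreement E (dot_product n d) p) ^ i"
  have n: "n > 0" using assms by simp
  have finE: "finite E" using assms(3) finite_Zn_vectors by (rule finite_subset)
  have "(\<Sum>p\<in>E \<times> E. freq_sum n d E {0..<int n} p ^ i)
      = (\<Sum>p\<in>E \<times> E. of_real (real n ^ i * real (agreement E (dot_product n d) p) ^ i))"
    using assms(1) finE by (simp add: freq_sum_full power_mult_distrib)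
  also have "\<dots> = complex_of_real (real n ^ i * ?S)"
    by (simp only: of_real_sum[symmetric] sum_distrib_left)
  finally have eq: "(\<Sum>p\<in>E \<times> E. freq_sum n d E {0..<int n} p ^ i) = complex_of_real (real n ^ i * ?S)" .
  have "real n ^ i * ?S \<le> norm (complex_of_real (real n ^ i * ?S))"
    unfolding norm_of_real by (rule abs_ge_self)
  also have "\<dots> \<le> ?e ^ (j + 3) + real i * ((real n * ?e) ^ j * error_bound n d E)"
    using norm_moment_le[OF n assms(3), of j] unfolding i[symmetric] eq .
  finally have le: "real n ^ i * ?S \<le> ?e ^ (j + 3) + real i * ((real n * ?e) ^ j * error_bound n d E)" .
  have "error_bound n d E \<le> real n ^ d * ?e * (?t * real n * (real n / ?g) ^ (d - 1))"
    unfolding error_bound_def by (intro mult_left_mono sum_gcd_power_le n assms(2)) auto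
  then have "real i * ((real n * ?e) ^ j * error_bound n d E)
      \<le> real i * ((real n * ?e) ^ j * (real n ^ d * ?e * (?t * real n * (real n / ?g) ^ (d - 1))))"
    by (intro mult_left_mono) auto
  also have "\<dots> = real i * (?t * real n ^ (2 * d + i - 1) / ?g ^ (d - 1)) * ?e ^ i"
    unfolding expo power_add power_mult_distrib power_divide by (simp add: i)
  also have "\<dots> \<le> ?e\<^sup>2 * ?e ^ i"
    by (intro mult_right_mono large) auto
  also have "\<dots> = ?e ^ (j + 3)" by (simp add: i eval_nat_numeral)
  finally have "real n ^ i * ?S \<le> 2 * ?e ^ (j + 3)" using le by linarith
  moreover have "i + 2 = j + 3" by (simp add: i)
  ultimately show ?thesis by (simp only:)
qed

section \<open>Counting simplices\<close>

text \<open>On \<open>L\<close> the map \<open>f\<close> factors through \<open>h\<close>, by a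
  choice of preimages.\<close>

lemma card_image_le_finer_image:
  assumes "finite L" and "\<And>x y. x \<in> L \<Longrightarrow> y \<in> L \<Longrightarrow> h x = h y \<Longrightarrow> f x = f y"
  shows "card (f ` L) \<le> card (h ` L)"
proof -
  have "f ` L = (\<lambda>t. f (inv_into L h t)) ` (h ` L)"
    unfolding image_image
    by (intro image_cong refl assms(2)) (simp_all add: f_inv_into_f inv_into_into)
  moreover have "card ((\<lambda>t. f (inv_into L h t)) ` (h ` L)) \<le> card (h ` L)"
    using assms(1) by (intro card_image_le) simp
  ultimately show ?thesis by simp
qed

text \<open>Passage from nested lists to indexed types: the dot products above the diagonal
  determine \<open>tuple_type\<close>, and each vertex list witnesses its own simplex.\<close>

lemma card_tuple_types_le_simplices:
  assumes "finite E" "n > 1"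
  shows "card (tuple_type (dot_product n d) ` tuples E (Suc k)) \<le> card (dot_product_simplices n d k E)"
proof -
  let ?D = "dot_product n d" and ?L = "tuples E (Suc k)"
  define h where "h xs = restrict (\<lambda>(i, j). ?D (xs ! i) (xs ! j)) (simplex_index k)" for xs
  have fin: "finite (simplex_index k)"
    by (rule finite_subset[of _ "{..k} \<times> {..k}"]) (auto simp: simplex_index_def)
  have "finite (simplex_types n k)"
    unfolding simplex_types_def carrier_Zn by (intro finite_PiE fin) simp
  then have fin_simplices: "finite (dot_product_simplices n d k E)" by (simp add: dot_product_simplices_def)
  have "card (tuple_type ?D ` ?L) \<le> card (h ` ?L)"
  proof (rule card_image_le_finer_image)
    show "finite ?L" using assms by (simp add: finite_lists_length_eq)
    fix xs ys assume xs: "xs \<in> ?L" and ys: "ys \<in> ?L" and eq: "h xs = h ys"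
    show "tuple_type ?D xs = tuple_type ?D ys"
    proof (rule tuple_type_eqI)
      fix i j assume "i < j" "j < length xs"
      then have "(i, j) \<in> simplex_index k" using xs by (simp add: simplex_index_def)
      then show "?D (xs ! i) (xs ! j) = ?D (ys ! i) (ys ! j)"
        using fun_cong[OF eq, of "(i, j)"] by (simp add: h_def)
    qed (use xs ys in simp)
  qed
  also have "h ` ?L \<subseteq> dot_product_simplices n d k E"
  proof clarify
    fix xs assume xs: "set xs \<subseteq> E" "length xs = Suc k"
    have "h xs \<in> simplex_types n k"
      using assms(2) by (auto simp: h_def simplex_types_def carrier_Zn dot_product_eq)
    moreover have "\<forall>i\<le>k. xs ! i \<in> E" using xs by (auto simp: subset_eq)
    moreover have "\<forall>i j. i < j \<and> j \<le> k \<longrightarrow> ?D (xs ! i) (xs ! j) = h xs (i, j)"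
      by (auto simp: h_def simplex_index_def)
    ultimately show "h xs \<in> dot_product_simplices n d k E"
      unfolding dot_product_simplices_def by (auto intro!: exI[of _ "(!) xs"])
  qed
  then have "card (h ` ?L) \<le> card (dot_product_simplices n d k E)"
    by (rule card_mono[OF fin_simplices])
  finally show ?thesis .
qed

theorem theorem2p6:
  fixes d k :: nat
  assumes "d \<ge> 1" and "1 \<le> k" and "k \<le> d"
  shows "\<exists>C c :: real. \<exists>N :: nat. C > 0 \<and> c > 0 \<and>
    (\<forall>n E. n \<ge> N \<longrightarrow> odd n \<longrightarrow> E \<subseteq> Zn_vectors n d \<longrightarrow>
      real (card E) \<ge> C * (sqrt (real (num_divisors n)) *
          real n powr (real d + (real k - 1) / 2) /
          real (least_prime_divisor n) powr ((real d - 1) / 2)) \<longrightarrow>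
      real (card (dot_product_simplices n d k E)) \<ge> c * real n ^ ((k + 1) choose 2))"
proof (intro exI conjI allI impI)
  \<comment> \<open>With \<open>C = sqrt k\<close>, squaring the size hypothesis produces the factor
    \<open>k\<close> that dominates the factor \<open>i\<close> in the moment bound. The constant
    \<open>c\<close> is the density for the family of all tuples, \<open>\<eta> = 1\<close>.\<close>
  show "sqrt (real k) > 0" using assms by simp
  show "simplex_density k 1 > 0" by (rule simplex_density_pos) simp
  fix n :: nat and E
  \<comment> \<open>Taking \<open>N = 2\<close> ensures \<open>n > 1\<close>, so that
    \<open>n\<close> has a least prime divisor.\<close>
  assume n2: "n \<ge> 2" and E: "E \<subseteq> Zn_vectors n d"
  let ?e = "real (card E)" and ?g = "real (least_prime_divisor n)" and ?t = "real (num_divisors n)"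
  define X where "X = sqrt ?t * real n powr (real d + (real k - 1) / 2) / ?g powr ((real d - 1) / 2)"
  assume "?e \<ge> sqrt (real k) * (sqrt ?t *
      real n powr (real d + (real k - 1) / 2) / ?g powr ((real d - 1) / 2))"
  then have eX: "?e \<ge> sqrt (real k) * X" by (simp add: X_def)
  have n1: "n > 1" using n2 by simp
  have g: "?g > 0" using gcd_le_div_least_prime(2)[of 1 n] n1 by simp
  have "1 \<in> {m. m dvd n}" "finite {m. m dvd n}" using n1 by simp_all
  then have "card {m. m dvd n} > 0" using card_gt_0_iff by blast
  then have t: "?t > 0" by (simp add: num_divisors_def)
  have X: "X > 0" using n1 g t by (simp add: X_def)
  \<comment> \<open>Squaring doubles the exponents to natural numbers, which turns the real powers
    into ordinary ones.\<close>
  have "real d + (real k - 1) / 2 + (real d + (real k - 1) / 2) = real (2 * d + k - 1)"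
    using assms(2) by (simp add: of_nat_diff)
  then have "(real n powr (real d + (real k - 1) / 2))\<^sup>2 = real n powr real (2 * d + k - 1)"
    by (simp only: power2_eq_square powr_add[symmetric])
  also have "\<dots> = real n ^ (2 * d + k - 1)" using n1 by (intro powr_realpow) simp
  finally have n_powr: "(real n powr (real d + (real k - 1) / 2))\<^sup>2 = real n ^ (2 * d + k - 1)" .
  have "(?g powr ((real d - 1) / 2))\<^sup>2 = ?g powr real (d - 1)"
    using assms(1) by (simp add: power2_eq_square powr_add[symmetric] of_nat_diff)
  also have "\<dots> = ?g ^ (d - 1)" by (intro powr_realpow g)
  finally have g_powr: "(?g powr ((real d - 1) / 2))\<^sup>2 = ?g ^ (d - 1)" .
  have X2: "X\<^sup>2 = ?t * real n ^ (2 * d + k - 1) / ?g ^ (d - 1)"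
    using t by (simp only: X_def power_divide power_mult_distrib n_powr g_powr) simp
  have "(sqrt (real k) * X)\<^sup>2 \<le> ?e\<^sup>2"
    using eX X by (intro power_mono) auto
  then have kX: "real k * X\<^sup>2 \<le> ?e\<^sup>2" by (simp add: power_mult_distrib)
  have finE: "finite E" using E finite_Zn_vectors by (rule finite_subset)
  have "sqrt (real k) * X > 0" using assms X by simp
  then have "?e > 0" using eX by linarith
  then have "E \<noteq> {}" by auto
  have "simplex_density k 1 * real n ^ (Suc k choose 2)
      \<le> real (card (tuple_type (dot_product n d) ` tuples E (Suc k)))"
  \<comment> \<open>Applied with \<open>q = n\<close> and the family of all tuples, which has
    density 1.\<close>
  proof (rule card_tuple_types_ge[where E = E])
    fix i assume i: "1 \<le> i" "i \<le> k"
    \<comment> \<open>Both \<open>i\<close> and the power of \<open>n\<close> increase with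
      \<open>i\<close>, so the condition at \<open>k\<close> implies those at all smaller
      orders.\<close>
    have "real i * (?t * real n ^ (2 * d + i - 1) / ?g ^ (d - 1))
        \<le> real k * (?t * real n ^ (2 * d + k - 1) / ?g ^ (d - 1))"
    proof (rule mult_mono)
      have "real n ^ (2 * d + i - 1) \<le> real n ^ (2 * d + k - 1)"
        by (rule power_increasing) (use i n1 in simp_all)
      then show "?t * real n ^ (2 * d + i - 1) / ?g ^ (d - 1) \<le> ?t * real n ^ (2 * d + k - 1) / ?g ^ (d - 1)"
        by (intro divide_right_mono mult_left_mono) simp_all
    qed (use i in simp_all)
    also have "\<dots> \<le> ?e\<^sup>2" using kX by (simp only: X2)
    finally show "real n ^ i * (\<Sum>p\<in>E \<times> E. real (agreement E (dot_product n d) p) ^ i)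
        \<le> 2 * ?e ^ (i + 2)"
      by (rule moment_agreement_le[OF n1 assms(1) E i(1)])
  next
    show "1 * ?e ^ Suc k \<le> real (card (tuples E (Suc k)))"
      unfolding card_lists_length_eq[OF finE] by simp
  qed (use finE \<open>E \<noteq> {}\<close> n1 in simp_all)
  also have "\<dots> \<le> real (card (dot_product_simplices n d k E))"
    by (intro of_nat_mono card_tuple_types_le_simplices finE n1)
  finally show "simplex_density k 1 * real n ^ ((k + 1) choose 2)
      \<le> real (card (dot_product_simplices n d k E))" by simp
qed

end
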